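(* Let $\mathcal{M}$ be a $d$-dimensional Riemannian submanifold of $\mathbb{R}^D$ with condition number $\tau$, and let $S \subset \mathcal{M}$ be a finite data set. Then for any $\epsilon \leq \frac{1}{4}$, $S$ has local covariance dimension $\left(d,\epsilon,\frac{\sqrt{\epsilon}\,\tau}{3}\right)$; that is, for every closed ball $B$ of radius $\frac{\sqrt{\epsilon}\tau}{3}$ in $\mathbb{R}^D$, writing $S_B = S \cap B$ and $\mu = \mathrm{mean}(S_B)$, there is a $d$-dimensional linear subspace $P \subset \mathbb{R}^D$ with $\sum_{x \in S_B}\|\pi_P(x-\mu)\|^2 \geq (1-\epsilon)\sum_{x\in S_B}\|x-\mu\|^2$, where $\pi_P$ is the orthogonal projection onto $P$ (equivalently, after an isometry of $\mathbb{R}^D$ taking $P$ to a coordinate subspace, some $d$ diagonal entries of the covariance matrix of $S_B$ account for at least a $(1-\epsilon)$ fraction of its trace).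
   Context: Condition number: $\mathcal{M}$ has condition number $\tau$ (in the sense of Niyogi–Smale–Weinberger) if $\tau$ is the largest number such that the open normal segments of radius less than $\tau$ at distinct points of $\mathcal{M}$ are disjoint (i.e. $\tau$ is the reach of $\mathcal{M}$). Local covariance dimension: a set $S \subset \mathbb{R}^D$ has local covariance dimension $(d,\epsilon,r)$ if, for its restriction to any ball of radius $r$, there is an isometry of $\mathbb{R}^D$ under which the covariance matrix of the restricted set has some $d$ diagonal elements contributing at least a $(1-\epsilon)$ fraction of its trace. *)

theory Defs
  imports "HOL-Analysis.Analysis"
begin

text \<open>\<open>C\<^sup>k\<close> maps on an open set: all iterated directional derivatives up to order \<open>k\<close> exist as
  Frechet derivatives, and those of order \<open>k\<close> are continuous.\<close>

primrec C_k_on :: "nat \<Rightarrow> 'a::euclidean_space set \<Rightarrow> ('a \<Rightarrow> 'b::euclidean_space) \<Rightarrow> bool" where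
  "C_k_on 0 S f \<longleftrightarrow> continuous_on S f"
| "C_k_on (Suc k) S f \<longleftrightarrow>
     (\<forall>x\<in>S. f differentiable (at x)) \<and>
     (\<forall>v. C_k_on k S (\<lambda>x. frechet_derivative f (at x) v))"

definition smooth_on :: "'a::euclidean_space set \<Rightarrow> ('a \<Rightarrow> 'b::euclidean_space) \<Rightarrow> bool" where
  "smooth_on S f \<longleftrightarrow> (\<forall>k. C_k_on k S f)"

definition diffeomorphism ::
  "'a::euclidean_space set \<Rightarrow> 'b::euclidean_space set \<Rightarrow> ('a \<Rightarrow> 'b) \<Rightarrow> ('b \<Rightarrow> 'a) \<Rightarrow> bool" where
  "diffeomorphism U V \<phi> \<psi> \<longleftrightarrow>
     open U \<and> open V \<and> homeomorphism U V \<phi> \<psi> \<and> smooth_on U \<phi> \<and> smooth_on V \<psi>"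

text \<open>Embedded smooth \<open>d\<close>-dimensional submanifolds without boundary, described by slice charts.
  The Riemannian metric is the one induced by the ambient inner product, so it is not
  additional data.\<close>

definition submanifold :: "nat \<Rightarrow> 'a::euclidean_space set \<Rightarrow> bool" where
  "submanifold d M \<longleftrightarrow>
     (\<forall>p\<in>M. \<exists>U V \<phi> \<psi> (W::'a set).
        p \<in> U \<and> diffeomorphism U V \<phi> \<psi> \<and> subspace W \<and> dim W = d \<and>
        \<phi> ` (U \<inter> M) = V \<inter> W)"

definition tangent_space :: "'a::euclidean_space set \<Rightarrow> 'a \<Rightarrow> 'a set" where
  "tangent_space M p =
     {v. \<exists>(\<gamma>::real \<Rightarrow> 'a) e. 0 < e \<and> smooth_on {-e<..<e} \<gamma> \<and> \<gamma> ` {-e<..<e} \<subseteq> M \<and>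
           \<gamma> 0 = p \<and> (\<gamma> has_vector_derivative v) (at 0)}"

definition normal_space :: "'a::euclidean_space set \<Rightarrow> 'a \<Rightarrow> 'a set" where
  "normal_space M p = orthogonal_comp (tangent_space M p)"

text \<open>The union of all open segments of length \<open>r\<close> that start at \<open>p\<close> and are normal to \<open>M\<close> there.\<close>

definition normal_segments :: "'a::euclidean_space set \<Rightarrow> 'a \<Rightarrow> real \<Rightarrow> 'a set" where
  "normal_segments M p r = {p + v |v. v \<in> normal_space M p \<and> norm v < r}"

definition normal_segments_disjoint :: "'a::euclidean_space set \<Rightarrow> real \<Rightarrow> bool" where
  "normal_segments_disjoint M t \<longleftrightarrow>
     (\<forall>r<t. \<forall>p\<in>M. \<forall>q\<in>M. p \<noteq> q \<longrightarrow> normal_segments M p r \<inter> normal_segments M q r = {})"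

text \<open>No real number qualifies when the normal segments never meet, e.g. for an affine subspace.\<close>

definition has_condition_number :: "'a::euclidean_space set \<Rightarrow> real \<Rightarrow> bool" where
  "has_condition_number M \<tau> \<longleftrightarrow>
     normal_segments_disjoint M \<tau> \<and> (\<forall>t. normal_segments_disjoint M t \<longrightarrow> t \<le> \<tau>)"

text \<open>Both are intended for finite \<open>A\<close>; for \<open>A = {}\<close> they are \<open>0\<close>.\<close>

definition mean :: "'a::euclidean_space set \<Rightarrow> 'a" where
  "mean A = (\<Sum>x\<in>A. x) /\<^sub>R real (card A)"

definition covariance_matrix :: "(real^'n) set \<Rightarrow> real^'n^'n" where
  "covariance_matrix A =
     (\<chi> i j. (\<Sum>x\<in>A. (x - mean A) $ i * (x - mean A) $ j) / real (card A))"

definition local_covariance_dimension ::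
  "(real^'n) set \<Rightarrow> nat \<Rightarrow> real \<Rightarrow> real \<Rightarrow> bool" where
  "local_covariance_dimension S d \<epsilon> r \<longleftrightarrow>
     (\<forall>c. \<exists>f::real^'n \<Rightarrow> real^'n.
        (\<forall>x y. dist (f x) (f y) = dist x y) \<and>
        (let C = covariance_matrix (f ` (S \<inter> cball c r)) in
           \<exists>I::'n set. card I = d \<and> (\<Sum>i\<in>I. C $ i $ i) \<ge> (1 - \<epsilon>) * trace C))"

definition orthogonal_projection :: "'a::euclidean_space set \<Rightarrow> 'a \<Rightarrow> 'a" where
  "orthogonal_projection P x = (THE y. y \<in> P \<and> x - y \<in> orthogonal_comp P)"

end

theory Submission
  imports Defs
begin

text \<open>
  A shortest segment from a point \<open>p + w\<close> to the closed set \<open>M\<close> is normal to \<open>M\<close> at its foot.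
  If \<open>w\<close> is normal at \<open>p\<close> and shorter than \<open>\<tau>\<close>, disjointness of the normal segments forces the
  foot to be \<open>p\<close>, so the ball of radius \<open>norm w\<close> about \<open>p + w\<close> has no point of \<open>M\<close> in its
  interior. Letting \<open>norm w\<close> tend to \<open>\<tau>\<close>, every \<open>q \<in> M\<close> lies within
  \<open>(norm (q - p))\<^sup>2 / (2 * \<tau>)\<close> of the affine tangent space at \<open>p\<close>. Take \<open>p\<close> to be the point of
  \<open>S \<inter> B\<close> nearest to the mean: then the second moment about \<open>p\<close> is at most twice that about the
  mean, and projecting to the tangent space at \<open>p\<close> loses at most the fraction
  \<open>2 * \<epsilon> / 9\<close> of the second moment.
\<close>

section \<open>Orthogonal projections onto subspaces\<close>

lemma orthogonal_projection_unique:
  assumes "subspace P" "y \<in> P" "x - y \<in> orthogonal_comp P"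
  shows "orthogonal_projection P x = y"
  unfolding orthogonal_projection_def
proof (rule the_equality)
  fix z assume z: "z \<in> P \<and> x - z \<in> orthogonal_comp P"
  have "z - y \<in> P"
    using z assms by (simp add: subspace_diff)
  moreover have "(x - y) - (x - z) \<in> orthogonal_comp P"
    using z assms subspace_orthogonal_comp subspace_diff by blast
  ultimately have "orthogonal (z - y) (z - y)"
    by (simp add: orthogonal_comp_def)
  then show "z = y"
    by (simp add: orthogonal_self)
qed (use assms in simp)

lemma orthogonal_projection_works:
  fixes P :: "'a::euclidean_space set"
  assumes "subspace P"
  shows "orthogonal_projection P x \<in> P" "x - orthogonal_projection P x \<in> orthogonal_comp P"
proof -
  obtain y z where "y \<in> span P" "\<And>w. w \<in> span P \<Longrightarrow> orthogonal z w" "x = y + z"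
    using orthogonal_subspace_decomp_exists by blast
  then have "y \<in> P" "x - y \<in> orthogonal_comp P"
    using assms by (auto simp: orthogonal_comp_def orthogonal_commute span_eq_iff[THEN iffD2])
  moreover from this have "orthogonal_projection P x = y"
    using assms orthogonal_projection_unique by blast
  ultimately show "orthogonal_projection P x \<in> P"
    "x - orthogonal_projection P x \<in> orthogonal_comp P"
    by auto
qed

lemma linear_orthogonal_projection:
  fixes P :: "'a::euclidean_space set"
  assumes P: "subspace P"
  shows "linear (orthogonal_projection P)"
proof (rule linearI)
  note w = orthogonal_projection_works[OF P]
  note c = subspace_orthogonal_comp[of P]
  fix x y and r :: real
  have "(x - orthogonal_projection P x) + (y - orthogonal_projection P y) \<in> orthogonal_comp P"
    using w c by (simp add: subspace_add)
  then show "orthogonal_projection P (x + y) = orthogonal_projection P x + orthogonal_projection P y"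
    using w P by (intro orthogonal_projection_unique) (auto simp: subspace_add algebra_simps)
  have "r *\<^sub>R (x - orthogonal_projection P x) \<in> orthogonal_comp P"
    using w c by (simp add: subspace_scale)
  then show "orthogonal_projection P (r *\<^sub>R x) = r *\<^sub>R orthogonal_projection P x"
    using w P by (intro orthogonal_projection_unique) (auto simp: subspace_scale algebra_simps)
qed

lemma norm_orthogonal_projection_Pythagoras:
  fixes P :: "'a::euclidean_space set"
  assumes "subspace P"
  shows "(norm x)\<^sup>2 = (norm (orthogonal_projection P x))\<^sup>2 + (norm (x - orthogonal_projection P x))\<^sup>2"
proof -
  have "orthogonal (orthogonal_projection P x) (x - orthogonal_projection P x)"
    using orthogonal_projection_works[OF assms, of x] by (simp add: orthogonal_comp_def)
  from norm_add_Pythagorean[OF this] show ?thesis by simp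
qed

section \<open>Second moments about the mean\<close>

lemma sum_diff_mean:
  fixes A :: "'a::euclidean_space set"
  assumes "finite A"
  shows "(\<Sum>x\<in>A. x - mean A) = 0"
  using assms unfolding sum_subtractf sum_constant_scaleR mean_def by (cases "A = {}") simp_all

text \<open>Parallel axis identity: when the square is expanded around the mean, the cross term is
  an inner product with the sum of the deviations, which vanishes. The linear map \<open>h\<close>
  serves for the identity as well as for the projection to the normal part.\<close>

lemma sum_norm_sq_about_mean:
  fixes A :: "'a::euclidean_space set" and h :: "'a \<Rightarrow> 'b::euclidean_space"
  assumes A: "finite A" and h: "linear h"
  shows "(\<Sum>x\<in>A. (norm (h (x - a)))\<^sup>2) =
    (\<Sum>x\<in>A. (norm (h (x - mean A)))\<^sup>2) + real (card A) * (norm (h (mean A - a)))\<^sup>2"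
proof -
  have "(\<Sum>x\<in>A. (norm (h (x - a)))\<^sup>2) =
    (\<Sum>x\<in>A. (norm (h (x - mean A)))\<^sup>2 + (norm (h (mean A - a)))\<^sup>2
      + 2 * (h (x - mean A) \<bullet> h (mean A - a)))"
  proof (rule sum.cong[OF refl])
    fix x
    have "h (x - a) = h (x - mean A) + h (mean A - a)"
      by (simp flip: linear_add[OF h])
    then show "(norm (h (x - a)))\<^sup>2 = (norm (h (x - mean A)))\<^sup>2 + (norm (h (mean A - a)))\<^sup>2
      + 2 * (h (x - mean A) \<bullet> h (mean A - a))"
      by (simp add: power2_norm_eq_inner inner_simps inner_commute)
  qed
  moreover have "(\<Sum>x\<in>A. h (x - mean A) \<bullet> h (mean A - a)) = 0"
    by (simp flip: inner_sum_left linear_sum[OF h] add: sum_diff_mean[OF A] linear_0[OF h])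
  ultimately show ?thesis
    by (simp add: sum.distrib sum_distrib_left[symmetric])
qed

section \<open>Nearest points and balls tangent to the manifold\<close>

lemma tangent_spaceE:
  assumes "v \<in> tangent_space M p"
  obtains \<gamma> e where "0 < e" "\<gamma> ` {-e<..<e} \<subseteq> M" "\<gamma> 0 = p" "(\<gamma> has_vector_derivative v) (at 0)"
  using assms unfolding tangent_space_def mem_Collect_eq by (elim exE conjE) (rule that)

text \<open>First variation: along a curve in \<open>M\<close> through \<open>q\<close> the squared
  distance to \<open>y\<close> is minimal at parameter 0, so its derivative there,
  \<open>-2 * (v \<bullet> (y - q))\<close>, is zero.\<close>

lemma nearest_point_normal:
  assumes q: "q \<in> M" and near: "\<And>x. x \<in> M \<Longrightarrow> dist y q \<le> dist y x"
  shows "y - q \<in> normal_space M q"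
proof -
  have "v \<bullet> (y - q) = 0" if v: "v \<in> tangent_space M q" for v
  proof -
    obtain \<gamma> e where e: "0 < e" "\<gamma> ` {-e<..<e} \<subseteq> M" "\<gamma> 0 = q"
      and d: "(\<gamma> has_vector_derivative v) (at 0)"
      using tangent_spaceE[OF v] .
    let ?f = "\<lambda>t. (y - \<gamma> t) \<bullet> (y - \<gamma> t)"
    have "(?f has_real_derivative (y - \<gamma> 0) \<bullet> (0 - v) + (0 - v) \<bullet> (y - \<gamma> 0)) (at 0)"
      unfolding has_real_derivative_iff_has_vector_derivative
      by (rule bounded_bilinear.has_vector_derivative[OF bounded_bilinear_inner])
         (intro derivative_intros d)+
    then have "(y - \<gamma> 0) \<bullet> (0 - v) + (0 - v) \<bullet> (y - \<gamma> 0) = 0"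
    proof (rule DERIV_local_min[OF _ e(1)])
      show "\<forall>t. \<bar>0 - t\<bar> < e \<longrightarrow> ?f 0 \<le> ?f t"
      proof (intro allI impI)
        fix t assume "\<bar>0 - t\<bar> < e"
        then have "\<gamma> t \<in> M"
          using e(2) by (auto simp: image_subset_iff abs_less_iff)
        from near[OF this] show "?f 0 \<le> ?f t"
          by (simp add: e(3) dist_norm norm_le)
      qed
    qed
    then show ?thesis
      by (simp add: e(3) inner_commute)
  qed
  then show ?thesis
    by (simp add: normal_space_def orthogonal_comp_def orthogonal_def)
qed

lemma normal_ball_avoids:
  assumes M: "closed M" "normal_segments_disjoint M \<tau>" and pq: "p \<in> M" "q \<in> M"
    and w: "w \<in> normal_space M p" "norm w < \<tau>"
  shows "norm w \<le> dist (p + w) q"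
proof -
  obtain z where z: "z \<in> M" "\<And>x. x \<in> M \<Longrightarrow> dist (p + w) z \<le> dist (p + w) x"
    using distance_attains_inf[OF M(1), of "p + w"] pq by blast
  have le: "dist (p + w) z \<le> norm w"
    using z(2)[OF pq(1)] by (simp add: dist_norm)
  \<comment> \<open>Segments are open and disjointness is given only for radii below \<tau>, so a
    radius strictly between \<open>norm w\<close> and \<tau> is needed for both segments to contain
    \<open>p + w\<close>.\<close>
  obtain r where r: "norm w < r" "r < \<tau>"
    using dense[OF w(2)] by blast
  have "p + w \<in> normal_segments M p r"
    using w r by (auto simp: normal_segments_def)
  moreover have "p + w \<in> normal_segments M z r"
    unfolding normal_segments_def
    using nearest_point_normal[OF z] le r
    by (intro CollectI exI[of _ "p + w - z"]) (auto simp: dist_norm)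
  ultimately have "z = p"
    using M(2) r z(1) pq(1) unfolding normal_segments_disjoint_def by blast
  with z(2)[OF pq(2)] show ?thesis
    by (simp add: dist_norm)
qed

text \<open>The ball of radius \<open>t < \<tau>\<close> that touches \<open>M\<close> at
  \<open>p\<close> in direction \<open>v\<close> does not contain \<open>q\<close> in its interior.
  Squaring this distance inequality cancels \<open>t\<^sup>2\<close> and leaves the claim with
  \<open>t\<close> in place of \<tau>.\<close>

lemma inner_normal_le:
  assumes M: "closed M" "normal_segments_disjoint M \<tau>" and "0 < \<tau>" and pq: "p \<in> M" "q \<in> M"
    and v: "v \<in> normal_space M p"
  shows "2 * \<tau> * (v \<bullet> (q - p)) \<le> norm v * (norm (q - p))\<^sup>2"
proof (cases "v = 0")
  case False
  let ?a = "v \<bullet> (q - p)" and ?b = "norm v * (norm (q - p))\<^sup>2"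
  have le: "2 * t * ?a \<le> ?b" if t: "0 < t" "t < \<tau>" for t
  proof -
    let ?w = "(t / norm v) *\<^sub>R v"
    have nw: "norm ?w = t"
      using t False by simp
    have "?w \<in> normal_space M p"
      using v unfolding normal_space_def by (simp add: subspace_scale subspace_orthogonal_comp)
    from normal_ball_avoids[OF M pq this] have "norm ?w \<le> norm (?w - (q - p))"
      using nw t by (simp add: dist_norm algebra_simps)
    then have "2 * (?w \<bullet> (q - p)) \<le> (norm (q - p))\<^sup>2"
      by (simp only: norm_le power2_norm_eq_inner inner_diff) (simp add: inner_commute)
    then show ?thesis
      using False by (simp add: field_simps)
  qed
  \<comment> \<open>The ball argument requires \<open>t < \<tau>\<close>; the non-strict bound
    survives the limit from the left.\<close>
  have "((\<lambda>t. 2 * t * ?a) \<longlongrightarrow> 2 * \<tau> * ?a) (at_left \<tau>)"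
    by (intro tendsto_intros)
  then show ?thesis
  proof (rule tendsto_upperbound)
    show "\<forall>\<^sub>F t in at_left \<tau>. 2 * t * ?a \<le> ?b"
      using le eventually_at_left_real[OF \<open>0 < \<tau>\<close>] by (auto elim: eventually_mono)
  qed simp
qed simp

section \<open>Tangent vectors in a slice chart\<close>

lemma submanifold_tangent_subspace:
  fixes M :: "'a::euclidean_space set"
  assumes "submanifold d M" "p \<in> M"
  obtains P where "subspace P" "dim P = d" "tangent_space M p \<subseteq> P"
proof -
  obtain U V \<phi> \<psi> and W :: "'a set" where pU: "p \<in> U" and diff: "diffeomorphism U V \<phi> \<psi>"
    and W: "subspace W" "dim W = d" and slice: "\<phi> ` (U \<inter> M) = V \<inter> W"
    using assms unfolding submanifold_def by blast
  have UV: "open U" "open V" and hom: "homeomorphism U V \<phi> \<psi>"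
    and "C_k_on (Suc 0) U \<phi>" "C_k_on (Suc 0) V \<psi>"
    using diff unfolding diffeomorphism_def smooth_on_def by blast+
  have \<phi>p: "\<phi> p \<in> V" and inv: "\<And>x. x \<in> U \<Longrightarrow> \<psi> (\<phi> x) = x" "\<And>y. y \<in> V \<Longrightarrow> \<phi> (\<psi> y) = y"
    using hom pU by (auto simp: homeomorphism_def)
  obtain D E where D: "(\<phi> has_derivative D) (at p)" and E: "(\<psi> has_derivative E) (at (\<phi> p))"
    using \<open>C_k_on (Suc 0) U \<phi>\<close> \<open>C_k_on (Suc 0) V \<psi>\<close> pU \<phi>p unfolding C_k_on.simps differentiable_def
    by blast
  have "linear D" "linear E"
    using D E has_derivative_linear by blast+
  have ED: "E (D x) = x" for x
  proof -
    have "((\<lambda>x. x) has_derivative (\<lambda>x. E (D x))) (at p)"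
      using inv UV pU by (intro has_derivative_transform_within_open[OF has_derivative_compose[OF D E]])
    from has_derivative_unique[OF this has_derivative_ident] show ?thesis
      by meson
  qed
  then have "surj E"
    by (metis surjI)
  then have "inj E"
    using \<open>linear E\<close> linear_surjective_imp_injective by blast
  show thesis
  proof
    show "subspace (E ` W)"
      using W \<open>linear E\<close> by (simp add: linear_subspace_image)
    show "dim (E ` W) = d"
      using W \<open>linear E\<close> \<open>inj E\<close> by (metis dim_image_eq inj_on_subset subset_UNIV)
    show "tangent_space M p \<subseteq> E ` W"
    proof
      fix v assume "v \<in> tangent_space M p"
      then obtain \<gamma> e where e: "0 < e" "\<gamma> ` {-e<..<e} \<subseteq> M" "\<gamma> 0 = p"
        and d: "(\<gamma> has_vector_derivative v) (at 0)"
        by (rule tangent_spaceE)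
      have "isCont \<gamma> 0"
        using d has_vector_derivative_continuous by blast
      then have "\<forall>\<^sub>F t in at 0. \<gamma> t \<in> U"
        using UV(1) pU e(3) by (auto simp: isCont_def dest: topological_tendstoD)
      moreover have "\<forall>\<^sub>F t in at 0. t \<in> {-e<..<e}"
        using e(1) by (intro eventually_at_in_open') auto
      ultimately have "\<forall>\<^sub>F t in at 0. \<phi> (\<gamma> t) \<in> W"
      proof eventually_elim
        case (elim t)
        then show ?case using e(2) slice by blast
      qed
      \<comment> \<open>The filter \<open>at 0\<close> leaves out the parameter 0 itself, which is
        added here so that the later comparison of derivatives holds on a full
        neighbourhood.\<close>
      moreover have "\<phi> p \<in> W"
        using slice pU assms(2) by blast
      ultimately have ev: "\<forall>\<^sub>F t in nhds 0. \<phi> (\<gamma> t) \<in> W"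
        by (simp add: eventually_nhds_conv_at e(3))
      have d\<phi>: "((\<lambda>t. \<phi> (\<gamma> t)) has_vector_derivative D v) (at 0)"
        using vector_derivative_diff_chain_within[of \<gamma> v 0 UNIV \<phi> D] d D e(3)
        by (simp add: o_def has_derivative_at_withinI)
      \<comment> \<open>Membership in \<open>W\<close> is tested through the double orthogonal
        complement: each \<open>z\<close> orthogonal to \<open>W\<close> annihilates the curve near
        0, hence also its velocity.\<close>
      have "z \<bullet> D v = 0" if z: "z \<in> orthogonal_comp W" for z
      proof -
        have "((\<lambda>t. z \<bullet> \<phi> (\<gamma> t)) has_real_derivative z \<bullet> D v) (at 0)"
          unfolding has_real_derivative_iff_has_vector_derivative
          by (rule bounded_linear.has_vector_derivative[OF bounded_linear_inner_right d\<phi>])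
        moreover have "\<forall>\<^sub>F t in nhds 0. z \<bullet> \<phi> (\<gamma> t) = 0"
          using ev z
          by (auto simp: orthogonal_comp_def orthogonal_def inner_commute elim!: eventually_mono)
        ultimately have "((\<lambda>t. 0) has_real_derivative z \<bullet> D v) (at 0)"
          by (subst DERIV_cong_ev[OF refl _ refl, symmetric])
        then show ?thesis
          by (rule DERIV_unique[OF _ DERIV_const])
      qed
      then have "D v \<in> orthogonal_comp (orthogonal_comp W)"
        by (simp add: orthogonal_comp_def[of "orthogonal_comp W"] orthogonal_def)
      then have "D v \<in> W"
        using orthogonal_comp_self[OF W(1)] by simp
      then show "v \<in> E ` W"
        using ED[of v] by force
    qed
  qed
qed

lemma submanifold_dim_le:
  fixes M :: "'a::euclidean_space set"
  assumes "submanifold d M" "p \<in> M"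
  shows "d \<le> DIM('a)"
proof -
  obtain P :: "'a set" where "dim P = d"
    using submanifold_tangent_subspace[OF assms] by blast
  then show ?thesis
    using dim_subset_UNIV by blast
qed

section \<open>Distance to the tangent space and the second moment estimate\<close>

text \<open>The component \<open>v\<close> of \<open>q - p\<close> orthogonal to \<open>P\<close> is
  itself normal to \<open>M\<close> at \<open>p\<close>. With it as the test vector,
  \<open>v \<bullet> (q - p)\<close> equals the square of \<open>norm v\<close>, and one factor
  \<open>norm v\<close> cancels from the bound on inner products.\<close>

lemma norm_normal_part_le:
  fixes M :: "'a::euclidean_space set"
  assumes M: "closed M" "normal_segments_disjoint M \<tau>" and "0 < \<tau>" and pq: "p \<in> M" "q \<in> M"
    and P: "subspace P" "tangent_space M p \<subseteq> P"
  shows "2 * \<tau> * norm (q - p - orthogonal_projection P (q - p)) \<le> (norm (q - p))\<^sup>2"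
proof -
  let ?u = "orthogonal_projection P (q - p)"
  define v where "v = q - p - ?u"
  note proj = orthogonal_projection_works[OF P(1), of "q - p", folded v_def]
  have "v \<in> normal_space M p"
    using proj(2) orthogonal_comp_anti_mono[OF P(2)] unfolding normal_space_def by blast
  then have "2 * \<tau> * (v \<bullet> (q - p)) \<le> norm v * (norm (q - p))\<^sup>2"
    by (rule inner_normal_le[OF M \<open>0 < \<tau>\<close> pq])
  moreover have "v \<bullet> (q - p) = norm v * norm v"
  proof -
    have "v \<bullet> ?u = 0"
      using proj by (simp add: orthogonal_comp_def orthogonal_def inner_commute[of v])
    moreover have "q - p = ?u + v"
      by (simp add: v_def)
    ultimately show ?thesis
      by (metis add_0 inner_add_right power2_eq_square power2_norm_eq_inner)
  qed
  ultimately have "norm v * (2 * \<tau> * norm v) \<le> norm v * (norm (q - p))\<^sup>2"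
    by (simp add: mult_ac)
  then have "2 * \<tau> * norm v \<le> (norm (q - p))\<^sup>2"
    by (cases "v = 0") auto
  then show ?thesis
    by (simp add: v_def)
qed

text \<open>The mean need not lie on \<open>M\<close>, whereas the tangent estimate needs a base
  point there. The estimate is therefore made at a data point \<open>p\<close> and carried over to
  the mean by the parallel axis identity.\<close>

lemma exists_subspace_second_moment:
  fixes M B :: "'a::euclidean_space set"
  assumes M: "submanifold d M" "closed M" "normal_segments_disjoint M \<tau>" and "0 \<le> \<tau>"
    and B: "finite B" "B \<subseteq> M" "B \<noteq> {}" and "0 \<le> \<epsilon>"
    and diam: "\<And>x y. x \<in> B \<Longrightarrow> y \<in> B \<Longrightarrow> dist x y \<le> 2 * (sqrt \<epsilon> * \<tau> / 3)"
  obtains P where "subspace P" "dim P = d"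
    "(1 - \<epsilon>) * (\<Sum>x\<in>B. (norm (x - mean B))\<^sup>2)
      \<le> (\<Sum>x\<in>B. (norm (orthogonal_projection P (x - mean B)))\<^sup>2)"
proof -
  let ?\<mu> = "mean B"
  obtain p where p: "p \<in> B" "\<And>x. x \<in> B \<Longrightarrow> dist ?\<mu> p \<le> dist ?\<mu> x"
    using distance_attains_inf[OF finite_imp_closed[OF B(1)], of ?\<mu>] B(3) by blast
  then have "p \<in> M"
    using B by blast
  then obtain P where P: "subspace P" "dim P = d" "tangent_space M p \<subseteq> P"
    using submanifold_tangent_subspace M(1) by blast
  let ?n = "\<lambda>x. x - orthogonal_projection P x"
  have lin: "linear ?n"
    using linear_compose_sub[OF linear_ident linear_orthogonal_projection[OF P(1)]] .
  have normal: "(norm (?n (x - p)))\<^sup>2 \<le> \<epsilon> / 9 * (norm (x - p))\<^sup>2" if x: "x \<in> B" for x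
  \<comment> \<open>For \<open>\<tau> = 0\<close> the diameter bound forces \<open>x = p\<close>,
    and both sides vanish.\<close>
  proof (cases "\<tau> = 0")
    case True
    then show ?thesis
      using diam[OF x p(1)] linear_0[OF lin] by simp
  next
    case False
    then have "0 < \<tau>"
      using \<open>0 \<le> \<tau>\<close> by simp
    have "2 * \<tau> * norm (?n (x - p)) \<le> norm (x - p) * norm (x - p)"
      using norm_normal_part_le[OF M(2,3) \<open>0 < \<tau>\<close> \<open>p \<in> M\<close> _ P(1,3)] x B(2)
      by (auto simp: power2_eq_square)
    \<comment> \<open>Only one of the two factors \<open>norm (x - p)\<close> is replaced by the
      diameter bound. Dividing by \<open>2 * \<tau>\<close> leaves
      \<open>sqrt \<epsilon> / 3\<close>, whose square is the constant
      \<open>\<epsilon> / 9\<close>.\<close>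
    also have "\<dots> \<le> 2 * (sqrt \<epsilon> * \<tau> / 3) * norm (x - p)"
      using diam[OF x p(1)] by (intro mult_right_mono) (auto simp: dist_norm)
    finally have "norm (?n (x - p)) \<le> sqrt \<epsilon> / 3 * norm (x - p)"
      using \<open>0 < \<tau>\<close> by (simp add: field_simps)
    then have "(norm (?n (x - p)))\<^sup>2 \<le> (sqrt \<epsilon> / 3 * norm (x - p))\<^sup>2"
      by (intro power_mono) auto
    then show ?thesis
      using \<open>0 \<le> \<epsilon>\<close> by (simp add: power_mult_distrib power_divide)
  qed
  define s where "s = (\<Sum>x\<in>B. (norm (x - ?\<mu>))\<^sup>2)"
  \<comment> \<open>Since \<open>p\<close> is the data point nearest to the mean, every summand of
    \<open>s\<close> is at least the squared distance from the mean to \<open>p\<close>. So the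
    shift term of the parallel axis identity is at most \<open>s\<close>.\<close>
  have "real (card B) * (norm (?\<mu> - p))\<^sup>2 \<le> s"
    unfolding s_def using p(2)
    by (intro sum_bounded_below) (auto simp: dist_norm norm_minus_commute intro!: power_mono)
  then have about_p: "(\<Sum>x\<in>B. (norm (x - p))\<^sup>2) \<le> 2 * s"
    using sum_norm_sq_about_mean[OF B(1) linear_ident, of p] by (simp add: s_def)
  \<comment> \<open>For the normal parts the return from \<open>p\<close> to the mean costs nothing,
    because the second moment is smallest about the mean.\<close>
  have "(\<Sum>x\<in>B. (norm (?n (x - ?\<mu>)))\<^sup>2) \<le> (\<Sum>x\<in>B. (norm (?n (x - p)))\<^sup>2)"
    using sum_norm_sq_about_mean[OF B(1) lin, of p] by simp
  also have "\<dots> \<le> \<epsilon> / 9 * (\<Sum>x\<in>B. (norm (x - p))\<^sup>2)"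
    unfolding sum_distrib_left using normal by (intro sum_mono)
  also have "\<dots> \<le> \<epsilon> / 9 * (2 * s)"
    using about_p \<open>0 \<le> \<epsilon>\<close> by (intro mult_left_mono) auto
  also have "\<dots> \<le> \<epsilon> * s"
    using \<open>0 \<le> \<epsilon>\<close> by (simp add: s_def sum_nonneg)
  finally have "(\<Sum>x\<in>B. (norm (?n (x - ?\<mu>)))\<^sup>2) \<le> \<epsilon> * s" .
  moreover have "s = (\<Sum>x\<in>B. (norm (orthogonal_projection P (x - ?\<mu>)))\<^sup>2)
      + (\<Sum>x\<in>B. (norm (?n (x - ?\<mu>)))\<^sup>2)"
    unfolding s_def sum.distrib[symmetric]
    by (intro sum.cong refl norm_orthogonal_projection_Pythagoras[OF P(1)])
  ultimately show thesis
    using P(1,2) by (intro that[of P]) (auto simp: s_def algebra_simps)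
qed

section \<open>From subspaces to diagonal entries of covariance matrices\<close>

text \<open>By dimension count, \<open>P\<close> embeds isometrically into the vectors supported on
  \<open>I\<close> and its orthogonal complement into those supported on \<open>- I\<close>. The map
  \<open>f\<close> is the sum of these two embeddings applied to the two components of
  \<open>x\<close>.\<close>

lemma exists_isometry_coordinate_subspace:
  fixes P :: "(real^'n) set"
  assumes P: "subspace P"
  obtains f :: "real^'n \<Rightarrow> real^'n" and I :: "'n set" where "linear f" "\<And>x. norm (f x) = norm x"
    "card I = dim P" "\<And>x. (\<Sum>i\<in>I. (f x $ i)\<^sup>2) = (norm (orthogonal_projection P x))\<^sup>2"
proof -
  obtain I :: "'n set" where I: "card I = dim P"
    using obtain_subset_with_card_n[of "dim P" "UNIV :: 'n set"] dim_subset_UNIV_cart[of P] by auto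
  let ?Q = "\<lambda>I :: 'n set. {x :: real^'n. \<forall>i. i \<notin> I \<longrightarrow> x $ i = 0}"
  have Q: "subspace (?Q J)" "dim (?Q J) = card J" for J
    by (auto simp: subspace_def dim_substandard_cart simp flip: dim_vec_eq)
  have "orthogonal_comp P = {y \<in> UNIV. \<forall>x\<in>P. orthogonal x y}"
    by (auto simp: orthogonal_comp_def)
  then have "dim (orthogonal_comp P) + dim P = CARD('n)"
    using dim_subspace_orthogonal_to_vectors[OF P subspace_UNIV] by simp
  then have "dim (orthogonal_comp P) \<le> dim (?Q (- I))"
    using I Q(2)[of "- I"] by (simp add: Compl_eq_Diff_UNIV card_Diff_subset)
  then obtain g where g: "linear g" "g \<in> orthogonal_comp P \<rightarrow> ?Q (- I)"
    "\<And>x. x \<in> orthogonal_comp P \<Longrightarrow> norm (g x) = norm x"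
    using isometry_subset_subspace[OF subspace_orthogonal_comp Q(1)] by blast
  obtain h where h: "linear h" "h \<in> P \<rightarrow> ?Q I" "\<And>x. x \<in> P \<Longrightarrow> norm (h x) = norm x"
    using isometry_subset_subspace[OF P Q(1), of I] I Q(2)[of I] by auto
  let ?p = "orthogonal_projection P"
  let ?f = "\<lambda>x. h (?p x) + g (x - ?p x)"
  note proj = orthogonal_projection_works[OF P] and lin = linear_orthogonal_projection[OF P]
  \<comment> \<open>The two images have disjoint supports, so each coordinate of \<open>?f x\<close>
    comes from just one component.\<close>
  have f_nth: "?f x $ i = (if i \<in> I then h (?p x) $ i else g (x - ?p x) $ i)" for x i
    using h(2) g(2) proj[of x] by (auto simp: Pi_iff)
  have norm_sum: "(norm y)\<^sup>2 = (\<Sum>i\<in>UNIV. (y $ i)\<^sup>2)" for y :: "real^'n"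
    by (simp add: power2_norm_eq_inner inner_vec_def) (simp add: power2_eq_square)
  have normI: "(\<Sum>i\<in>I. (?f x $ i)\<^sup>2) = (norm (?p x))\<^sup>2" for x
  proof -
    have "(\<Sum>i\<in>I. (?f x $ i)\<^sup>2) = (\<Sum>i\<in>UNIV. (h (?p x) $ i)\<^sup>2)"
      unfolding f_nth using h(2) proj(1)[of x] by (intro sum.mono_neutral_cong_left) auto
    also have "\<dots> = (norm (?p x))\<^sup>2"
      using h(3) proj(1)[of x] by (simp add: norm_sum[symmetric])
    finally show ?thesis .
  qed
  have normC: "(\<Sum>i\<in>- I. (?f x $ i)\<^sup>2) = (norm (x - ?p x))\<^sup>2" for x
  proof -
    have "(\<Sum>i\<in>- I. (?f x $ i)\<^sup>2) = (\<Sum>i\<in>UNIV. (g (x - ?p x) $ i)\<^sup>2)"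
      unfolding f_nth using g(2) proj(2)[of x] by (intro sum.mono_neutral_cong_left) auto
    also have "\<dots> = (norm (x - ?p x))\<^sup>2"
      using g(3) proj(2)[of x] by (simp add: norm_sum[symmetric])
    finally show ?thesis .
  qed
  show thesis
  proof
    show "linear ?f"
      using linear_compose_add[OF linear_compose[OF lin h(1)]
          linear_compose[OF linear_compose_sub[OF linear_ident lin] g(1)]]
      by (simp add: o_def)
    have "(norm (?f x))\<^sup>2 = (norm x)\<^sup>2" for x
      unfolding norm_sum[of "?f x"] norm_orthogonal_projection_Pythagoras[OF P, of x]
        normI[symmetric] normC[symmetric]
      by (simp add: sum.union_disjoint[symmetric])
    then show "norm (?f x) = norm x" for x
      by (simp add: power2_eq_iff_nonneg)
  qed (use I normI in auto)
qed

text \<open>Linearity lets \<open>f\<close> commute with the mean, and injectivity prevents points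
  of \<open>B\<close> from merging in the image set.\<close>

lemma covariance_matrix_linear_image_diag:
  fixes f :: "real^'n \<Rightarrow> real^'n"
  assumes f: "linear f" "inj f" and "finite B"
  shows "covariance_matrix (f ` B) $ i $ i = (\<Sum>x\<in>B. (f (x - mean B) $ i)\<^sup>2) / real (card B)"
proof -
  have inj: "inj_on f B"
    using f(2) by (rule inj_on_subset) simp
  have "mean (f ` B) = f (mean B)"
    by (simp add: mean_def sum.reindex[OF inj] card_image[OF inj] linear_sum[OF f(1)] linear_scale[OF f(1)])
  then show ?thesis
    by (simp add: covariance_matrix_def sum.reindex[OF inj] card_image[OF inj] linear_diff[OF f(1)] power2_eq_square)
qed

lemma local_covariance_dimension_if_subspaces:
  fixes S :: "(real^'n) set"
  assumes "finite S"
    and P: "\<And>c. \<exists>P. subspace P \<and> dim P = d \<and>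
       (let B = S \<inter> cball c r; \<mu> = mean B in
          (\<Sum>x\<in>B. (norm (orthogonal_projection P (x - \<mu>)))\<^sup>2)
            \<ge> (1 - \<epsilon>) * (\<Sum>x\<in>B. (norm (x - \<mu>))\<^sup>2))"
  shows "local_covariance_dimension S d \<epsilon> r"
  unfolding local_covariance_dimension_def
proof
  fix c
  define B where "B = S \<inter> cball c r"
  have "finite B"
    using assms(1) by (simp add: B_def)
  obtain P where P: "subspace P" "dim P = d"
    and le: "(1 - \<epsilon>) * (\<Sum>x\<in>B. (norm (x - mean B))\<^sup>2)
      \<le> (\<Sum>x\<in>B. (norm (orthogonal_projection P (x - mean B)))\<^sup>2)"
    using P[of c] by (auto simp: B_def Let_def)
  obtain f :: "real^'n \<Rightarrow> real^'n" and I :: "'n set" where f: "linear f" "\<And>x. norm (f x) = norm x"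
    and I: "card I = d" "\<And>x. (\<Sum>i\<in>I. (f x $ i)\<^sup>2) = (norm (orthogonal_projection P x))\<^sup>2"
    using exists_isometry_coordinate_subspace[OF P(1)] P(2) by metis
  have dist: "dist (f x) (f y) = dist x y" for x y
    using f by (simp add: dist_norm flip: linear_diff)
  then have "inj f"
    by (metis dist_eq_0_iff injI)
  let ?C = "covariance_matrix (f ` B)"
  \<comment> \<open>Stated for every \<open>J\<close> because two cases are used:
    \<open>UNIV\<close> yields the trace, and \<open>I\<close> the second moment of the
    projections.\<close>
  have diag: "(\<Sum>i\<in>J. ?C $ i $ i) = (\<Sum>x\<in>B. \<Sum>i\<in>J. (f (x - mean B) $ i)\<^sup>2) / real (card B)" for J
    unfolding covariance_matrix_linear_image_diag[OF f(1) \<open>inj f\<close> \<open>finite B\<close>]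
      sum_divide_distrib[symmetric] by (subst sum.swap) simp
  have "(\<Sum>i\<in>UNIV. (f x $ i)\<^sup>2) = (norm x)\<^sup>2" for x
    using f(2)[of x] by (simp add: norm_vec_def L2_set_def sum_nonneg flip: f(2))
  then have "trace ?C = (\<Sum>x\<in>B. (norm (x - mean B))\<^sup>2) / real (card B)"
    by (simp add: trace_def diag)
  moreover have "(\<Sum>i\<in>I. ?C $ i $ i)
      = (\<Sum>x\<in>B. (norm (orthogonal_projection P (x - mean B)))\<^sup>2) / real (card B)"
    by (simp add: diag I(2))
  \<comment> \<open>If \<open>B\<close> is empty, division by \<open>card B = 0\<close> makes both
    sides 0.\<close>
  ultimately have "(1 - \<epsilon>) * trace ?C \<le> (\<Sum>i\<in>I. ?C $ i $ i)"
    using le by (simp add: divide_right_mono)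
  then show "\<exists>f::real^'n \<Rightarrow> real^'n. (\<forall>x y. dist (f x) (f y) = dist x y) \<and>
      (let C = covariance_matrix (f ` (S \<inter> cball c r)) in
         \<exists>I::'n set. card I = d \<and> (\<Sum>i\<in>I. C $ i $ i) \<ge> (1 - \<epsilon>) * trace C)"
    using dist I(1) unfolding B_def Let_def by blast
qed

theorem theorem5:
  fixes M S :: "(real^'n) set" and d :: nat and \<tau> \<epsilon> :: real
  assumes "submanifold d M"
    and "closed M"
    and "has_condition_number M \<tau>"
    and "finite S" and "S \<subseteq> M"
    and "0 \<le> \<epsilon>" and "\<epsilon> \<le> 1 / 4"
  shows "local_covariance_dimension S d \<epsilon> (sqrt \<epsilon> * \<tau> / 3) \<and>
    (\<forall>c. \<exists>P. subspace P \<and> dim P = d \<and>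
       (let B = S \<inter> cball c (sqrt \<epsilon> * \<tau> / 3); \<mu> = mean B in
          (\<Sum>x\<in>B. (norm (orthogonal_projection P (x - \<mu>)))\<^sup>2)
            \<ge> (1 - \<epsilon>) * (\<Sum>x\<in>B. (norm (x - \<mu>))\<^sup>2)))"
proof -
  have \<tau>: "normal_segments_disjoint M \<tau>" "\<And>t. normal_segments_disjoint M t \<Longrightarrow> t \<le> \<tau>"
    using assms(3) by (auto simp: has_condition_number_def)
  \<comment> \<open>Below radius 0 all segments are empty, so 0 satisfies the disjointness condition
    and maximality of \<tau> gives \<open>0 \<le> \<tau>\<close>.\<close>
  have "normal_segments M p r = {}" if "r < 0" for p r
    using that by (auto simp: normal_segments_def dest: less_trans[of _ r 0])
  then have "0 \<le> \<tau>"
    by (intro \<tau>(2)) (simp add: normal_segments_disjoint_def)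
  \<comment> \<open>For empty \<open>M\<close> every number would qualify, in particular
    \<open>\<tau> + 1\<close>, against maximality. A point of \<open>M\<close> then bounds
    \<open>d\<close> by the ambient dimension, which supplies a \<open>d\<close>-dimensional
    subspace for balls that contain no data.\<close>
  have "M \<noteq> {}"
    using \<tau>(2)[of "\<tau> + 1"] by (auto simp: normal_segments_disjoint_def)
  then have "d \<le> dim (UNIV :: (real^'n) set)"
    using submanifold_dim_le[OF assms(1)] by auto
  then obtain P\<^sub>0 :: "(real^'n) set" where P\<^sub>0: "subspace P\<^sub>0" "dim P\<^sub>0 = d"
    using choose_subspace_of_subspace by metis
  have "\<exists>P. subspace P \<and> dim P = d \<and>
       (let B = S \<inter> cball c (sqrt \<epsilon> * \<tau> / 3); \<mu> = mean B in
          (\<Sum>x\<in>B. (norm (orthogonal_projection P (x - \<mu>)))\<^sup>2)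
            \<ge> (1 - \<epsilon>) * (\<Sum>x\<in>B. (norm (x - \<mu>))\<^sup>2))" for c
  proof (cases "S \<inter> cball c (sqrt \<epsilon> * \<tau> / 3) = {}")
    case True
    then show ?thesis
      using P\<^sub>0 by (auto simp: Let_def)
  next
    case False
    have "dist x y \<le> 2 * (sqrt \<epsilon> * \<tau> / 3)"
      if "x \<in> S \<inter> cball c (sqrt \<epsilon> * \<tau> / 3)" "y \<in> S \<inter> cball c (sqrt \<epsilon> * \<tau> / 3)" for x y
      using that dist_triangle3[of x y c] by simp
    from exists_subspace_second_moment[OF assms(1,2) \<tau>(1) \<open>0 \<le> \<tau>\<close> _ _ False assms(6) this]
    show ?thesis
      using assms(4,5) unfolding Let_def by (metis finite_Int le_infI1)
  qed
  with local_covariance_dimension_if_subspaces[OF assms(4)] show ?thesis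
    by blast
qed

end
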